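(* Let $(H;\langle\cdot,\cdot\rangle)$ be an infinite dimensional Hilbert space over $\mathbb{K}$ and $(e_i)_{i\in\mathbb{N}}$ an orthonormal family in $H$. Let $\Gamma=(\Gamma_i)_{i\in\mathbb{N}},\ \gamma=(\gamma_i)_{i\in\mathbb{N}},\ \phi=(\phi_i)_{i\in\mathbb{N}},\ \Phi=(\Phi_i)_{i\in\mathbb{N}}\in\ell^2(\mathbb{K})$ with $\Gamma\ne\pm\gamma$ and $\Phi\neq\pm\phi$, and let $x,y\in H$ be such that either $$\left\|x-\sum_{i=1}^\infty\frac{\Gamma_i+\gamma_i}{2}e_i\right\|\le\frac12\left(\sum_{i=1}^\infty|\Gamma_i-\gamma_i|^2\right)^{1/2},\qquad \left\|y-\sum_{i=1}^\infty\frac{\Phi_i+\phi_i}{2}e_i\right\|\le\frac12\left(\sum_{i=1}^\infty|\Phi_i-\phi_i|^2\right)^{1/2},$$ or, equivalently, $$\operatorname{Re}\left\langle\sum_{i=1}^\infty\Gamma_ie_i-x,\ x-\sum_{i=1}^\infty\gamma_ie_i\right\rangle\ge0,\qquad \operatorname{Re}\left\langle\sum_{i=1}^\infty\Phi_ie_i-y,\ y-\sum_{i=1}^\infty\phi_ie_i\right\rangle\ge0$$ holds. Then $$\left|\langle x,y\rangle-\sum_{i=1}^\infty\langle x,e_i\rangle\langle e_i,y\rangle\right|\le\frac14\left(\sum_{i=1}^\infty|\Phi_i-\phi_i|^2\right)^{1/2}\left(\sum_{i=1}^\infty|\Gamma_i-\gamma_i|^2\right)^{1/2}\times\frac{\left[\|x\|+\left(\sum_{i=1}^\infty|\langle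 x,e_i\rangle|^2\right)^{1/2}\right]^{1/2}\left[\|y\|+\left(\sum_{i=1}^\infty|\langle y,e_i\rangle|^2\right)^{1/2}\right]^{1/2}}{\left(\sum_{i=1}^\infty|\Phi_i+\phi_i|^2\right)^{1/4}\left(\sum_{i=1}^\infty|\Gamma_i+\gamma_i|^2\right)^{1/4}}$$ $$\le\frac12\cdot\frac{\left(\sum_{i=1}^\infty|\Phi_i-\phi_i|^2\right)^{1/2}\left(\sum_{i=1}^\infty|\Gamma_i-\gamma_i|^2\right)^{1/2}}{\left(\sum_{i=1}^\infty|\Phi_i+\phi_i|^2\right)^{1/4}\left(\sum_{i=1}^\infty|\Gamma_i+\gamma_i|^2\right)^{1/4}}\,\|x\|^{1/2}\|y\|^{1/2} .$$
   Context: $\mathbb{K}$ denotes $\mathbb{R}$ or $\mathbb{C}$. Inner products are linear in the first argument and conjugate-linear in the second, and $\|x\|=\langle x,x\rangle^{1/2}$. A family $(e_i)_{i\in\mathbb{N}}$ is orthonormal if $\langle e_i,e_j\rangle=0$ for $i\ne j$ and $\|e_i\|=1$ for all $i$; it is not assumed to be complete. $\ell^2(\mathbb{K})$ is the space of sequences $(a_i)_{i\in\mathbb{N}}$ in $\mathbb{K}$ with $\sum_{i=1}^\infty|a_i|^2<\infty$; for $\lambda\in\ell^2(\mathbb{K})$ the series $\sum_i\lambda_ie_i$ converges in $H$. *)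

theory Defs
  imports "HOL-Analysis.Analysis" "Jordan_Normal_Form.Conjugate"
begin

text \<open>
  The scalar field \<open>\<K>\<close>, which is \<open>\<real>\<close> or \<open>\<complex>\<close>.  Up to isomorphism the instances below are the only
  ones: every \<open>x\<close> is a root of the real polynomial \<open>X\<^sup>2 - 2 (re x) X + (norm x)\<^sup>2\<close>, so the field is
  algebraic of degree at most 2 over \<open>\<real>\<close>; on \<open>\<complex>\<close> the last axiom excludes trivial conjugation and
  determines the norm.
\<close>

class real_or_complex = real_normed_field + conjugatable_field +
  fixes re :: "'a \<Rightarrow> real"
  assumes scaleR_re: "re x *\<^sub>R 1 = (x + conjugate x) / 2"
    and mult_conjugate: "x * conjugate x = (norm x)\<^sup>2 *\<^sub>R 1"

instantiation real :: real_or_complex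
begin
definition re_real :: "real \<Rightarrow> real" where "re_real x = x"
instance by standard (auto simp: re_real_def power2_eq_square)
end

instantiation complex :: real_or_complex
begin
definition re_complex :: "complex \<Rightarrow> real" where "re_complex = Re"
instance
proof
  fix x :: complex
  show "re x *\<^sub>R 1 = (x + conjugate x) / 2"
    by (simp add: re_complex_def complex_eq_iff)
  show "x * conjugate x = (norm x)\<^sup>2 *\<^sub>R 1"
    by (simp add: complex_eq_iff cmod_power2) (simp add: power2_eq_square)
qed
end

text \<open>
  Completeness is carried by the type class \<open>banach\<close>; the norm and the real scalar multiplication of
  that class are tied to the inner product and to the \<open>\<K>\<close>-scalar multiplication by the last two axioms.
\<close>

locale hilbert_space = vector_space smul
  for smul :: "'k::real_or_complex \<Rightarrow> 'h::banach \<Rightarrow> 'h" +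
  fixes ip :: "'h \<Rightarrow> 'h \<Rightarrow> 'k"
  assumes ip_add_left: "ip (x + y) z = ip x z + ip y z"
    and ip_smul_left: "ip (smul a x) y = a * ip x y"
    and ip_commute: "ip y x = conjugate (ip x y)"
    and ip_self_nonneg: "0 \<le> re (ip x x)"
    and ip_self_eq_0_iff: "ip x x = 0 \<longleftrightarrow> x = 0"
    and norm_eq_sqrt_ip: "norm x = sqrt (re (ip x x))"
    and scaleR_eq_smul: "r *\<^sub>R x = smul (of_real r) x"

lemma hilbert_space_real_inner:
  "hilbert_space scaleR (inner :: 'a::{real_inner, banach} \<Rightarrow> 'a \<Rightarrow> real)"
  by unfold_locales
    (simp_all add: re_real_def inner_add_left inner_add_right inner_commute norm_eq_sqrt_inner
      scaleR_add_right scaleR_add_left)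

lemma hilbert_space_complex: "hilbert_space (*) (\<lambda>x y :: complex. x * cnj y)"
  by unfold_locales
    (simp_all add: re_complex_def distrib_left distrib_right scaleR_conv_of_real,
      simp add: cmod_def power2_eq_square)

definition infinite_dimensional :: "('k::field \<Rightarrow> 'h::ab_group_add \<Rightarrow> 'h) \<Rightarrow> bool"
  where "infinite_dimensional smul \<longleftrightarrow> (\<nexists>B. finite B \<and> module.span smul B = UNIV)"

definition orthonormal_family ::
    "('h::real_normed_vector \<Rightarrow> 'h \<Rightarrow> 'k::zero) \<Rightarrow> (nat \<Rightarrow> 'h) \<Rightarrow> bool"
  where "orthonormal_family ip e \<longleftrightarrow>
    (\<forall>i j. i \<noteq> j \<longrightarrow> ip (e i) (e j) = 0) \<and> (\<forall>i. norm (e i) = 1)"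

definition ell2 :: "(nat \<Rightarrow> 'k::real_normed_vector) set"
  where "ell2 = {a. summable (\<lambda>i. (norm (a i))\<^sup>2)}"

end

theory Submission
  imports Defs
begin

text \<open>
  Write \<open>c\<close> for the centre and \<open>r\<close> for the radius of the ball containing \<open>x\<close>, and \<open>P\<close> for the orthogonal
  projection onto the closed span of the family, so that \<open>P c = c\<close>.  Then
  \<open>2 \<parallel>x\<parallel> \<parallel>c\<parallel> \<le> \<parallel>x\<parallel>\<^sup>2 + \<parallel>c\<parallel>\<^sup>2 \<le> r\<^sup>2 + 2 Re \<langle>P x, c\<rangle> \<le> r\<^sup>2 + 2 \<parallel>P x\<parallel> \<parallel>c\<parallel>\<close>, which bounds \<open>\<parallel>x\<parallel> - \<parallel>P x\<parallel>\<close> and hence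
  \<open>\<parallel>x - P x\<parallel>\<^sup>2 = (\<parallel>x\<parallel> - \<parallel>P x\<parallel>) (\<parallel>x\<parallel> + \<parallel>P x\<parallel>)\<close>.  The left-hand side of the theorem is \<open>\<bar>\<langle>x - P x, y - P y\<rangle>\<bar>\<close>, so
  the Cauchy-Schwarz inequality concludes.  The two forms of the hypothesis are equivalent because
  \<open>Re \<langle>2 p, 2 q\<rangle> = \<parallel>p + q\<parallel>\<^sup>2 - \<parallel>p - q\<parallel>\<^sup>2\<close>.
\<close>

section \<open>Real part, conjugation and norm in the scalar field\<close>

lemma of_real_re: "of_real (re x) = (x + conjugate x) / (2 :: 'k::real_or_complex)"
  using scaleR_re[of x] by (simp add: of_real_def)

lemma mult_conjugate_of_real: "x * conjugate x = of_real ((norm (x :: 'k::real_or_complex))\<^sup>2)"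
  using mult_conjugate[of x] by (simp add: of_real_def)

text \<open>Taking norms in \<open>mult_conjugate_of_real\<close> gives an equation in which
  \<open>norm x\<close> cancels.\<close>

lemma norm_conjugate [simp]: "norm (conjugate x) = norm (x :: 'k::real_or_complex)"
proof (cases "x = 0")
  case False
  have "norm x * norm (conjugate x) = norm x * norm x"
    by (metis abs_of_nonneg mult_conjugate_of_real norm_mult norm_of_real power2_eq_square
        zero_le_power2)
  then show ?thesis using False by simp
qed simp

text \<open>\<open>re\<close> is accessible through its image in \<open>'k\<close>, so the equation
  is checked there and pulled back by injectivity of \<open>of_real\<close>.\<close>

lemma re_add: "re (x + y) = re x + re (y :: 'k::real_or_complex)"
proof -
  have "(of_real (re (x + y)) :: 'k) = of_real (re x + re y)"
    by (simp add: of_real_re conjugate_dist_add add_divide_distrib)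
  then show ?thesis by (simp only: of_real_eq_iff)
qed

lemma re_minus: "re (- x) = - re (x :: 'k::real_or_complex)"
  using re_add[of x "- x"] re_add[of 0 "0 :: 'k"] by simp

lemma re_diff: "re (x - y) = re x - re (y :: 'k::real_or_complex)"
  using re_add[of x "- y"] by (simp add: re_minus)

lemma re_conjugate [simp]: "re (conjugate x) = re (x :: 'k::real_or_complex)"
proof -
  have "(of_real (re (conjugate x)) :: 'k) = of_real (re x)"
    by (simp add: of_real_re add.commute)
  then show ?thesis by (simp only: of_real_eq_iff)
qed

lemma abs_re_le_norm: "\<bar>re x\<bar> \<le> norm (x :: 'k::real_or_complex)"
proof -
  have "\<bar>re x\<bar> = norm ((x + conjugate x) / 2)"
    by (metis norm_of_real of_real_re)
  also have "\<dots> \<le> (norm x + norm (conjugate x)) / 2"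
    by (simp add: norm_divide norm_triangle_ineq del: norm_conjugate)
  finally show ?thesis by simp
qed

lemma conjugate_of_real [simp]: "conjugate (of_real r :: 'k::real_or_complex) = of_real r"
proof (cases "r = 0")
  case False
  have "(of_real r :: 'k) * conjugate (of_real r) = of_real r * of_real r"
    by (simp add: mult_conjugate_of_real power2_eq_square flip: of_real_mult)
  then show ?thesis using False by simp
qed simp

lemma re_of_real [simp]: "re (of_real r :: 'k::real_or_complex) = r"
proof -
  have "(of_real (re (of_real r :: 'k)) :: 'k) = of_real r"
    by (simp add: of_real_re)
  then show ?thesis by (simp only: of_real_eq_iff)
qed

section \<open>Closure properties of the square-summable sequences\<close>

lemma ell2_add:
  assumes "a \<in> ell2" "b \<in> ell2"
  shows "(\<lambda>i. a i + b i) \<in> ell2"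
  unfolding ell2_def mem_Collect_eq
proof (rule summable_comparison_test)
  show "summable (\<lambda>i. 2 * (norm (a i))\<^sup>2 + 2 * (norm (b i))\<^sup>2)"
    using assms unfolding ell2_def by (auto intro!: summable_add summable_mult)
  have "(norm (a i + b i))\<^sup>2 \<le> 2 * (norm (a i))\<^sup>2 + 2 * (norm (b i))\<^sup>2" for i
  proof -
    have "(norm (a i + b i))\<^sup>2 \<le> (norm (a i) + norm (b i))\<^sup>2"
      by (simp add: norm_triangle_ineq power_mono)
    \<comment> \<open>Absorbs the cross term \<open>2 * norm (a i) * norm (b i)\<close>.\<close>
    moreover have "0 \<le> (norm (a i) - norm (b i))\<^sup>2" by simp
    ultimately show ?thesis by (simp add: power2_sum power2_diff)
  qed
  then show "\<exists>N. \<forall>n\<ge>N. norm ((norm (a n + b n))\<^sup>2) \<le> 2 * (norm (a n))\<^sup>2 + 2 * (norm (b n))\<^sup>2"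
    by simp
qed

lemma ell2_mult:
  fixes a :: "nat \<Rightarrow> 'k::real_normed_field"
  assumes "a \<in> ell2"
  shows "(\<lambda>i. c * a i) \<in> ell2"
  using assms unfolding ell2_def by (auto simp: norm_mult power_mult_distrib intro!: summable_mult)

lemma ell2_diff:
  fixes a b :: "nat \<Rightarrow> 'k::real_normed_vector"
  assumes "a \<in> ell2" "b \<in> ell2"
  shows "(\<lambda>i. a i - b i) \<in> ell2"
proof -
  have "(\<lambda>i. - b i) \<in> ell2"
    using assms by (simp add: ell2_def)
  from ell2_add[OF assms(1) this] show ?thesis by simp
qed

section \<open>Geometry of the inner product\<close>

context hilbert_space
begin

lemma ip_zero_left [simp]: "ip 0 z = 0"
  using ip_add_left[of 0 0 z] by simp

lemma ip_minus_left: "ip (- x) z = - ip x z"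
  using ip_add_left[of x "- x" z] by (simp add: add_eq_0_iff)

lemma ip_diff_left: "ip (x - y) z = ip x z - ip y z"
  using ip_add_left[of x "- y" z] by (simp add: ip_minus_left)

lemma ip_add_right: "ip z (x + y) = ip z x + ip z y"
  by (metis conjugate_dist_add ip_add_left ip_commute)

lemma ip_zero_right [simp]: "ip z 0 = 0"
  using ip_add_right[of z 0 0] by simp

lemma ip_minus_right: "ip z (- x) = - ip z x"
  using ip_add_right[of z x "- x"] by (simp add: add_eq_0_iff)

lemma ip_diff_right: "ip z (x - y) = ip z x - ip z y"
  using ip_add_right[of z x "- y"] by (simp add: ip_minus_right)

lemma ip_smul_right: "ip x (smul a y) = conjugate a * ip x y"
  by (metis conjugate_dist_mul ip_commute ip_smul_left)

text \<open>By \<open>ip_commute\<close>, \<open>ip x x\<close> equals its conjugate, hence its real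
  part.\<close>

lemma ip_self: "ip x x = of_real ((norm x)\<^sup>2)"
proof -
  have "of_real (re (ip x x)) = ip x x"
    unfolding of_real_re ip_commute[of x x, symmetric] by simp
  moreover have "re (ip x x) = (norm x)\<^sup>2"
    by (simp add: norm_eq_sqrt_ip ip_self_nonneg)
  ultimately show ?thesis by simp
qed

lemma re_ip_commute: "re (ip x y) = re (ip y x)"
  by (metis ip_commute re_conjugate)

lemma norm_ip_commute: "norm (ip x y) = norm (ip y x)"
  by (metis ip_commute norm_conjugate)

lemma norm_diff_sq: "(norm (x - y))\<^sup>2 = (norm x)\<^sup>2 - 2 * re (ip x y) + (norm y)\<^sup>2"
proof -
  have "(norm (x - y))\<^sup>2 = re (ip (x - y) (x - y))"
    by (simp add: ip_self del: of_real_power)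
  also have "\<dots> = (norm x)\<^sup>2 - 2 * re (ip x y) + (norm y)\<^sup>2"
    unfolding ip_diff_left ip_diff_right re_diff re_ip_commute[of y x]
    by (simp add: ip_self del: of_real_power)
  finally show ?thesis .
qed

lemma norm_add_sq: "(norm (x + y))\<^sup>2 = (norm x)\<^sup>2 + 2 * re (ip x y) + (norm y)\<^sup>2"
  using norm_diff_sq[of x "- y"] by (simp add: ip_minus_right re_minus)

text \<open>The norm of \<open>'h\<close> is a priori homogeneous over the reals only; over
  \<open>'k\<close> this comes from \<open>ip_self\<close>.\<close>

lemma norm_smul: "norm (smul a x) = norm a * norm x"
proof -
  have "(of_real ((norm (smul a x))\<^sup>2) :: 'k) = of_real ((norm a * norm x)\<^sup>2)"
    using mult_conjugate_of_real[of a] ip_self[of x]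
    by (simp add: ip_self[symmetric] ip_smul_left ip_smul_right power_mult_distrib
        mult_ac del: of_real_power)
  then show ?thesis
    by (simp only: of_real_eq_iff power2_eq_iff_nonneg norm_ge_zero zero_le_mult_iff simp_thms)
qed

theorem Cauchy_Schwarz_ip: "norm (ip x y) \<le> norm x * norm y"
proof (cases "y = 0")
  case False
  \<comment> \<open>\<open>smul t y\<close> is the orthogonal projection of \<open>x\<close> onto
    the line through \<open>y\<close>; the inequality is the nonnegativity of the squared norm of
    \<open>x - smul t y\<close>.\<close>
  define t where "t = ip x y / of_real ((norm y)\<^sup>2)"
  have "re (ip x (smul t y)) = (norm (ip x y))\<^sup>2 / (norm y)\<^sup>2"
  proof -
    have "ip x (smul t y) = of_real ((norm (ip x y))\<^sup>2 / (norm y)\<^sup>2)"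
    proof -
      have "conjugate t * of_real ((norm y)\<^sup>2) = conjugate (t * of_real ((norm y)\<^sup>2))"
        by (simp only: conjugate_dist_mul conjugate_of_real)
      also have "\<dots> = conjugate (ip x y)"
        using False by (simp add: t_def)
      finally have "ip x (smul t y) * of_real ((norm y)\<^sup>2) = of_real ((norm (ip x y))\<^sup>2)"
        by (simp add: ip_smul_right mult_conjugate_of_real[symmetric] mult_ac del: of_real_power)
      then show ?thesis using False by (simp add: field_simps)
    qed
    then show ?thesis by (simp only: re_of_real)
  qed
  moreover have "(norm (smul t y))\<^sup>2 = (norm (ip x y))\<^sup>2 / (norm y)\<^sup>2"
    using False by (simp add: norm_smul t_def norm_divide power_mult_distrib power_divide
        norm_of_real power2_eq_square del: of_real_power of_real_mult)
  ultimately have "0 \<le> (norm x)\<^sup>2 - (norm (ip x y))\<^sup>2 / (norm y)\<^sup>2"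
    using norm_diff_sq[of x "smul t y"] zero_le_power2[of "norm (x - smul t y)"] by linarith
  then have "(norm (ip x y))\<^sup>2 \<le> (norm x * norm y)\<^sup>2"
    using False by (simp add: field_simps power_mult_distrib)
  then show ?thesis by (rule power2_le_imp_le) simp
qed simp

lemma bounded_linear_ip_left: "bounded_linear (\<lambda>x. ip x z)"
  by (rule bounded_linear_intro[where K = "norm z"])
    (simp_all only: ip_add_left scaleR_eq_smul ip_smul_left scaleR_conv_of_real Cauchy_Schwarz_ip)

text \<open>Used to pass \<open>ip\<close> through series. Conjugate-linear maps are linear over the
  reals because conjugation fixes the reals.\<close>

lemma bounded_linear_ip_right: "bounded_linear (\<lambda>x. ip z x)"
proof (rule bounded_linear_intro[where K = "norm z"])
  show "norm (ip z x) \<le> norm x * norm z" for x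
    by (subst norm_ip_commute) (rule Cauchy_Schwarz_ip)
qed (simp_all only: ip_add_right scaleR_eq_smul ip_smul_right conjugate_of_real scaleR_conv_of_real)

lemma re_ip_ball_iff:
  "0 \<le> re (ip (u - x) (x - v)) \<longleftrightarrow> norm (x - smul (1 / 2) (u + v)) \<le> 1 / 2 * norm (u - v)"
proof -
  \<comment> \<open>In these terms \<open>x\<close> minus the midpoint is \<open>q - p\<close>, half
    of \<open>u - v\<close> is \<open>p + q\<close>, and both conditions say that
    \<open>re (ip p q)\<close> is nonnegative.\<close>
  define p where "p = smul (1 / 2) (u - x)"
  define q where "q = smul (1 / 2) (x - v)"
  have half: "smul (1 / 2) z + smul (1 / 2) z = z" for z
    using scale_left_distrib[of "1 / 2" "1 / 2" z] by simp
  have split: "u - x = p + p" "x - v = q + q"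
    by (simp_all only: p_def q_def half)
  have *: "re (ip (u - x) (x - v)) = 4 * re (ip p q)"
    unfolding split ip_add_left ip_add_right re_add by simp
  have "u - v = (u - x) + (x - v)" by simp
  then have uv: "u - v = (p + q) + (p + q)"
    unfolding split by (simp only: add_ac)
  have "x - smul (1 / 2) (u + v) = q - p"
    using half[of x]
    by (simp add: p_def q_def scale_right_distrib scale_right_diff_distrib algebra_simps)
  moreover have "1 / 2 * norm (u - v) = norm (p + q)"
    unfolding uv scaleR_2[symmetric] by simp
  moreover have "norm (q - p) \<le> norm (p + q) \<longleftrightarrow> (norm (q - p))\<^sup>2 \<le> (norm (p + q))\<^sup>2"
    by simp
  ultimately show ?thesis
    unfolding * norm_diff_sq norm_add_sq by (simp add: re_ip_commute[of q p])
qed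

end

section \<open>Square-summable combinations of an orthonormal sequence\<close>

locale orthonormal_sequence = hilbert_space smul ip
  for smul :: "'k::real_or_complex \<Rightarrow> 'h::banach \<Rightarrow> 'h" and ip :: "'h \<Rightarrow> 'h \<Rightarrow> 'k" +
  fixes e :: "nat \<Rightarrow> 'h"
  assumes orthonormal: "orthonormal_family ip e"
begin

lemma ip_e: "ip (e i) (e j) = (if i = j then 1 else 0)"
  using orthonormal ip_self[of "e i"] by (auto simp: orthonormal_family_def)

lemma ip_sum_left: "ip (\<Sum>i\<in>A. f i) z = (\<Sum>i\<in>A. ip (f i) z)"
  by (rule linear_sum[OF bounded_linear.linear[OF bounded_linear_ip_left]])

lemma ip_finite_sum_e:
  assumes "finite A"
  shows "ip (\<Sum>i\<in>A. smul (a i) (e i)) (e j) = (if j \<in> A then a j else 0)"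
  using assms by (simp add: ip_sum_left ip_smul_left ip_e if_distrib sum.delta cong: if_cong)

text \<open>Pythagoras: each new term is orthogonal to the sum so far.\<close>

lemma norm_finite_sum_sq:
  assumes "finite A"
  shows "(norm (\<Sum>i\<in>A. smul (a i) (e i)))\<^sup>2 = (\<Sum>i\<in>A. (norm (a i))\<^sup>2)"
  using assms
proof (induction A)
  case (insert j A)
  have "ip (smul (a j) (e j)) (\<Sum>i\<in>A. smul (a i) (e i)) = 0"
    by (subst ip_commute) (use insert ip_finite_sum_e[of A a j] in \<open>simp add: ip_smul_right\<close>)
  moreover have "norm (e j) = 1" using orthonormal by (simp add: orthonormal_family_def)
  moreover have "re (0::'k) = 0" using re_of_real[of 0, where 'k='k] by simp
  ultimately show ?case using insert by (simp add: norm_add_sq norm_smul)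
qed simp

text \<open>A block of the series has as squared norm the same block of the scalar series, so the
  Cauchy criterion transfers and completeness gives convergence.\<close>

lemma summable_ell2:
  assumes "a \<in> ell2"
  shows "summable (\<lambda>i. smul (a i) (e i))"
  unfolding summable_Cauchy
proof (intro allI impI)
  fix r :: real assume "0 < r"
  moreover have "summable (\<lambda>i. (norm (a i))\<^sup>2)" using assms by (simp add: ell2_def)
  ultimately obtain N where N: "\<And>m n. m \<ge> N \<Longrightarrow> norm (\<Sum>i=m..<n. (norm (a i))\<^sup>2) < r\<^sup>2"
    unfolding summable_Cauchy by (metis zero_less_power)
  have "norm (\<Sum>i=m..<n. smul (a i) (e i)) < r" if "m \<ge> N" for m n
  proof -
    have "(norm (\<Sum>i=m..<n. smul (a i) (e i)))\<^sup>2 < r\<^sup>2"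
      using N[OF that, of n] by (simp add: norm_finite_sum_sq sum_nonneg)
    then show ?thesis using \<open>0 < r\<close> by (metis less_imp_le power2_less_imp_less)
  qed
  then show "\<exists>N. \<forall>m\<ge>N. \<forall>n. norm (\<Sum>i=m..<n. smul (a i) (e i)) < r" by blast
qed

text \<open>\<open>suminf\<close> is total, so the value is meaningful only where the series
  converges, in particular on \<open>ell2\<close>.\<close>

definition comb :: "(nat \<Rightarrow> 'k) \<Rightarrow> 'h"
  where "comb a = (\<Sum>i. smul (a i) (e i))"

lemma sums_comb: "a \<in> ell2 \<Longrightarrow> (\<lambda>i. smul (a i) (e i)) sums comb a"
  unfolding comb_def by (rule summable_sums[OF summable_ell2])

text \<open>Parseval's identity, by passing to the limit in
  \<open>norm_finite_sum_sq\<close>.\<close>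

lemma norm_comb_sq:
  assumes "a \<in> ell2"
  shows "(norm (comb a))\<^sup>2 = (\<Sum>i. (norm (a i))\<^sup>2)"
proof -
  have "(\<lambda>n. (norm (\<Sum>i<n. smul (a i) (e i)))\<^sup>2) \<longlonglongrightarrow> (norm (comb a))\<^sup>2"
    using sums_comb[OF assms] unfolding sums_def by (rule tendsto_power[OF tendsto_norm])
  then have "(\<lambda>i. (norm (a i))\<^sup>2) sums (norm (comb a))\<^sup>2"
    by (simp add: norm_finite_sum_sq sums_def)
  then show ?thesis by (rule sums_unique)
qed

lemma norm_comb: "a \<in> ell2 \<Longrightarrow> norm (comb a) = sqrt (\<Sum>i. (norm (a i))\<^sup>2)"
  by (simp flip: norm_comb_sq)

lemma comb_add: "a \<in> ell2 \<Longrightarrow> b \<in> ell2 \<Longrightarrow> comb (\<lambda>i. a i + b i) = comb a + comb b"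
  by (simp add: comb_def scale_left_distrib suminf_add summable_ell2)

lemma comb_diff: "a \<in> ell2 \<Longrightarrow> b \<in> ell2 \<Longrightarrow> comb (\<lambda>i. a i - b i) = comb a - comb b"
  by (simp add: comb_def scale_left_diff_distrib suminf_diff summable_ell2)

lemma comb_mult:
  assumes "a \<in> ell2"
  shows "comb (\<lambda>i. c * a i) = smul c (comb a)"
proof -
  \<comment> \<open>Continuity lets scaling by an element of \<open>'k\<close> commute with the
    infinite sum.\<close>
  have "bounded_linear (smul c)"
    by (rule bounded_linear_intro[where K = "norm c"])
      (simp_all add: scale_right_distrib scaleR_eq_smul norm_smul mult.commute)
  from bounded_linear.suminf[OF this summable_ell2[OF assms]] show ?thesis
    by (simp add: comb_def)
qed

lemma ip_comb_left:
  assumes "a \<in> ell2"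
  shows "(\<lambda>i. a i * ip (e i) z) sums ip (comb a) z"
  using bounded_linear.sums[OF bounded_linear_ip_left sums_comb[OF assms]]
  by (simp add: ip_smul_left)

lemma ip_comb_e: "a \<in> ell2 \<Longrightarrow> ip (comb a) (e j) = a j"
  using ip_comb_left[of a "e j"] sums_single[of j a]
  by (simp add: ip_e if_distrib sums_unique2 cong: if_cong)

lemma ip_comb_right_eq_0:
  assumes "a \<in> ell2" "\<And>i. ip z (e i) = 0"
  shows "ip z (comb a) = 0"
  using bounded_linear.sums[OF bounded_linear_ip_right sums_comb[OF assms(1)], of z] assms(2)
  by (simp add: ip_smul_right sums_unique2)

text \<open>Bessel's inequality: for a partial sum \<open>s\<close>, \<open>re (ip x s)\<close> is
  the square of \<open>norm s\<close>, so expanding the squared norm of \<open>x - s\<close> bounds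
  \<open>norm s\<close> by \<open>norm x\<close>.\<close>

lemma coeff_ell2: "(\<lambda>i. ip x (e i)) \<in> ell2"
  unfolding ell2_def mem_Collect_eq
proof (rule summableI_nonneg_bounded)
  fix n
  define s where "s = (\<Sum>i<n. smul (ip x (e i)) (e i))"
  have "ip x s = (\<Sum>i<n. conjugate (ip x (e i)) * ip x (e i))"
    unfolding s_def
    using linear_sum[OF bounded_linear.linear[OF bounded_linear_ip_right],
        of x "\<lambda>i. smul (ip x (e i)) (e i)" "{..<n}"]
    by (simp add: ip_smul_right)
  also have "\<dots> = of_real (\<Sum>i<n. (norm (ip x (e i)))\<^sup>2)"
    by (simp add: mult.commute[of "conjugate _"] mult_conjugate_of_real)
  finally have "re (ip x s) = (\<Sum>i<n. (norm (ip x (e i)))\<^sup>2)"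
    by (simp only: re_of_real)
  moreover have "(norm s)\<^sup>2 = (\<Sum>i<n. (norm (ip x (e i)))\<^sup>2)"
    by (simp add: s_def norm_finite_sum_sq)
  ultimately show "(\<Sum>i<n. (norm (ip x (e i)))\<^sup>2) \<le> (norm x)\<^sup>2"
    using norm_diff_sq[of x s] zero_le_power2[of "norm (x - s)"] by linarith
qed simp

section \<open>Orthogonal projection onto the closed span of the sequence\<close>

definition proj :: "'h \<Rightarrow> 'h"
  where "proj x = comb (\<lambda>i. ip x (e i))"

text \<open>\<open>x\<close> and \<open>proj x\<close> have the same coefficients, so their
  difference is orthogonal to every \<open>e i\<close> and, by continuity, to every
  combination.\<close>

lemma ip_diff_proj_comb: "a \<in> ell2 \<Longrightarrow> ip (x - proj x) (comb a) = 0"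
  by (rule ip_comb_right_eq_0) (simp_all add: proj_def ip_diff_left ip_comb_e coeff_ell2)

lemma norm_proj: "norm (proj x) = sqrt (\<Sum>i. (norm (ip x (e i)))\<^sup>2)"
  unfolding proj_def by (rule norm_comb[OF coeff_ell2])

lemma norm_sq_proj: "(norm x)\<^sup>2 = (norm (x - proj x))\<^sup>2 + (norm (proj x))\<^sup>2"
proof -
  have "ip (x - proj x) (proj x) = 0"
    unfolding proj_def[of x] using ip_diff_proj_comb[OF coeff_ell2, of x x] by (simp add: proj_def)
  then show ?thesis
    using norm_add_sq[of "x - proj x" "proj x"] re_of_real[of 0, where 'k='k] by simp
qed

lemma norm_proj_le: "norm (proj x) \<le> norm x"
  by (rule power2_le_imp_le) (simp_all add: norm_sq_proj[of x])

text \<open>The subtracted series is \<open>ip (proj x) y\<close>, and replacing \<open>y\<close> by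
  \<open>y - proj y\<close> is harmless because \<open>x - proj x\<close> is orthogonal to the
  combination \<open>proj y\<close>.\<close>

lemma ip_diff_proj:
  "ip x y - (\<Sum>i. ip x (e i) * ip (e i) y) = ip (x - proj x) (y - proj y)"
proof -
  have "ip (proj x) y = (\<Sum>i. ip x (e i) * ip (e i) y)"
    unfolding proj_def using ip_comb_left[OF coeff_ell2] by (rule sums_unique)
  moreover have "ip (x - proj x) (proj y) = 0"
    unfolding proj_def[of y] by (rule ip_diff_proj_comb[OF coeff_ell2])
  ultimately show ?thesis by (simp add: ip_diff_left ip_diff_right)
qed

text \<open>The norm of the centre is kept as a factor on the left, so the bound also makes sense
  for a centre at 0.\<close>

lemma norm_diff_proj_le_radius:
  assumes "a \<in> ell2" and "norm (x - comb a) \<le> r"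
  shows "(norm (x - proj x))\<^sup>2 * (2 * norm (comb a)) \<le> r\<^sup>2 * (norm x + norm (proj x))"
proof -
  let ?c = "comb a"
  \<comment> \<open>The component of \<open>x\<close> orthogonal to the span does not pair with the
    centre.\<close>
  have "re (ip x ?c) = re (ip (proj x) ?c)"
    using ip_diff_proj_comb[OF assms(1), of x] by (simp add: ip_diff_left)
  also have "\<dots> \<le> norm (proj x) * norm ?c"
    using abs_re_le_norm[of "ip (proj x) ?c"] Cauchy_Schwarz_ip[of "proj x" ?c] by linarith
  finally have "re (ip x ?c) \<le> norm (proj x) * norm ?c" .
  moreover have "(norm (x - ?c))\<^sup>2 \<le> r\<^sup>2"
    using assms(2) by (simp add: power_mono)
  moreover have "0 \<le> (norm x - norm ?c)\<^sup>2" by simp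
  ultimately have "(norm x - norm (proj x)) * (2 * norm ?c) \<le> r\<^sup>2"
    by (simp add: norm_diff_sq power2_diff algebra_simps)
  \<comment> \<open>The extra factor completes the difference of norms to a difference of
    squares.\<close>
  then have "(norm x - norm (proj x)) * (2 * norm ?c) * (norm x + norm (proj x))
      \<le> r\<^sup>2 * (norm x + norm (proj x))"
    by (rule mult_right_mono) simp
  moreover have "(norm (x - proj x))\<^sup>2 = (norm x - norm (proj x)) * (norm x + norm (proj x))"
    using norm_sq_proj[of x] by (simp add: power2_eq_square algebra_simps)
  ultimately show ?thesis by (simp add: mult_ac)
qed

section \<open>Balls given by two coefficient sequences\<close>

lemma suminf_sq_pos:
  fixes a :: "nat \<Rightarrow> 'k"
  assumes "a \<in> ell2" and "a i \<noteq> 0"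
  shows "0 < (\<Sum>i. (norm (a i))\<^sup>2)"
  using assms by (intro suminf_pos2[where i = i]) (simp_all add: ell2_def)

lemma comb_midpoint:
  assumes "a \<in> ell2" and "b \<in> ell2"
  shows "comb (\<lambda>i. (a i + b i) / 2) = smul (1 / 2) (comb a + comb b)"
  using comb_mult[OF ell2_add[OF assms], of "1 / 2"] by (simp add: comb_add[OF assms])

text \<open>This is \<open>re_ip_ball_iff\<close> at \<open>comb a\<close> and
  \<open>comb b\<close>; Parseval identifies the radius with half their distance.\<close>

lemma ball_iff_re:
  assumes "a \<in> ell2" and "b \<in> ell2"
  shows "norm (x - comb (\<lambda>i. (a i + b i) / 2)) \<le> 1 / 2 * sqrt (\<Sum>i. (norm (a i - b i))\<^sup>2) \<longleftrightarrow>
    0 \<le> re (ip (comb a - x) (x - comb b))"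
  unfolding re_ip_ball_iff comb_midpoint[OF assms] norm_comb[OF ell2_diff[OF assms], symmetric]
    comb_diff[OF assms] ..

lemma norm_diff_proj_le:
  assumes "a \<in> ell2" and "b \<in> ell2" and "a \<noteq> (\<lambda>i. - b i)"
    and ball: "norm (x - comb (\<lambda>i. (a i + b i) / 2)) \<le> 1 / 2 * sqrt (\<Sum>i. (norm (a i - b i))\<^sup>2)"
  shows "norm (x - proj x) \<le> 1 / 2 * sqrt (\<Sum>i. (norm (a i - b i))\<^sup>2) *
    sqrt (norm x + norm (proj x)) / (\<Sum>i. (norm (a i + b i))\<^sup>2) powr (1 / 4)"
proof -
  define r where "r = 1 / 2 * sqrt (\<Sum>i. (norm (a i - b i))\<^sup>2)"
  define S where "S = (\<Sum>i. (norm (a i + b i))\<^sup>2)"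
  have ab: "(\<lambda>i. a i + b i) \<in> ell2" using assms(1,2) by (rule ell2_add)
  \<comment> \<open>A nonzero coordinate makes \<open>S\<close> positive, so dividing by its fourth
    root is legitimate.\<close>
  obtain i where "a i + b i \<noteq> 0" using assms(3) by (metis add_eq_0_iff2 ext)
  then have "0 < S" unfolding S_def by (rule suminf_sq_pos[OF ab])
  then have pow: "S powr (1 / 4) = sqrt (sqrt S)"
    by (simp add: powr_powr flip: powr_half_sqrt)
  \<comment> \<open>\<open>r\<close> bounds a norm; its sign is needed to simplify
    \<open>sqrt (r\<^sup>2)\<close> to \<open>r\<close>.\<close>
  have "0 \<le> r" using order_trans[OF norm_ge_zero ball] by (simp add: r_def)
  have mid: "(\<lambda>i. (a i + b i) / 2) \<in> ell2"
    using ell2_mult[OF ab, of "1 / 2"] by simp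
  \<comment> \<open>The factor 2 of the radius estimate cancels the halving in the centre.\<close>
  have "2 * norm (comb (\<lambda>i. (a i + b i) / 2)) = sqrt S"
    using comb_mult[OF ab, of "1 / 2"] norm_comb[OF ab]
    by (simp add: norm_smul norm_divide S_def)
  with norm_diff_proj_le_radius[OF mid ball]
  have "(norm (x - proj x))\<^sup>2 * sqrt S \<le> r\<^sup>2 * (norm x + norm (proj x))"
    by (simp add: r_def)
  \<comment> \<open>Taking roots turns \<open>sqrt S\<close> into the fourth root in the
    claim.\<close>
  then have "sqrt ((norm (x - proj x))\<^sup>2 * sqrt S) \<le> sqrt (r\<^sup>2 * (norm x + norm (proj x)))"
    by (rule real_sqrt_le_mono)
  then have "norm (x - proj x) * sqrt (sqrt S) \<le> r * sqrt (norm x + norm (proj x))"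
    using \<open>0 \<le> r\<close> by (simp add: real_sqrt_mult)
  then have "norm (x - proj x) \<le> r * sqrt (norm x + norm (proj x)) / S powr (1 / 4)"
    using \<open>0 < S\<close> by (simp add: pow pos_le_divide_eq)
  then show ?thesis by (simp only: r_def S_def)
qed

lemma sqrt_norm_add_proj_le: "sqrt (norm x + norm (proj x)) \<le> sqrt 2 * sqrt (norm x)"
  using norm_proj_le[of x] by (simp flip: real_sqrt_mult)

end

theorem theorem10:
  fixes smul :: "'k::real_or_complex \<Rightarrow> 'h::banach \<Rightarrow> 'h"
    and ip :: "'h \<Rightarrow> 'h \<Rightarrow> 'k"
    and e :: "nat \<Rightarrow> 'h"
    and \<Gamma> \<gamma> \<phi> \<Phi> :: "nat \<Rightarrow> 'k"
    and x y :: 'h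
  assumes "hilbert_space smul ip"
    and "infinite_dimensional smul"
    and "orthonormal_family ip e"
    and "\<Gamma> \<in> ell2" and "\<gamma> \<in> ell2" and "\<phi> \<in> ell2" and "\<Phi> \<in> ell2"
    and "\<Gamma> \<noteq> \<gamma>" and "\<Gamma> \<noteq> (\<lambda>i. - \<gamma> i)"
    and "\<Phi> \<noteq> \<phi>" and "\<Phi> \<noteq> (\<lambda>i. - \<phi> i)"
  defines "ball_condition \<equiv>
      norm (x - (\<Sum>i. smul ((\<Gamma> i + \<gamma> i) / 2) (e i)))
        \<le> 1 / 2 * sqrt (\<Sum>i. (norm (\<Gamma> i - \<gamma> i))\<^sup>2) \<and>
      norm (y - (\<Sum>i. smul ((\<Phi> i + \<phi> i) / 2) (e i)))
        \<le> 1 / 2 * sqrt (\<Sum>i. (norm (\<Phi> i - \<phi> i))\<^sup>2)"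
    and "re_condition \<equiv>
      re (ip ((\<Sum>i. smul (\<Gamma> i) (e i)) - x) (x - (\<Sum>i. smul (\<gamma> i) (e i)))) \<ge> 0 \<and>
      re (ip ((\<Sum>i. smul (\<Phi> i) (e i)) - y) (y - (\<Sum>i. smul (\<phi> i) (e i)))) \<ge> 0"
  defines "middle \<equiv>
      1 / 4 * sqrt (\<Sum>i. (norm (\<Phi> i - \<phi> i))\<^sup>2) * sqrt (\<Sum>i. (norm (\<Gamma> i - \<gamma> i))\<^sup>2) *
      (sqrt (norm x + sqrt (\<Sum>i. (norm (ip x (e i)))\<^sup>2)) *
       sqrt (norm y + sqrt (\<Sum>i. (norm (ip y (e i)))\<^sup>2)) /
       ((\<Sum>i. (norm (\<Phi> i + \<phi> i))\<^sup>2) powr (1 / 4) *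
        (\<Sum>i. (norm (\<Gamma> i + \<gamma> i))\<^sup>2) powr (1 / 4)))"
  shows "(ball_condition \<longleftrightarrow> re_condition) \<and>
    (ball_condition \<or> re_condition \<longrightarrow>
      norm (ip x y - (\<Sum>i. ip x (e i) * ip (e i) y)) \<le> middle \<and>
      middle \<le>
        1 / 2 * (sqrt (\<Sum>i. (norm (\<Phi> i - \<phi> i))\<^sup>2) * sqrt (\<Sum>i. (norm (\<Gamma> i - \<gamma> i))\<^sup>2) /
          ((\<Sum>i. (norm (\<Phi> i + \<phi> i))\<^sup>2) powr (1 / 4) *
           (\<Sum>i. (norm (\<Gamma> i + \<gamma> i))\<^sup>2) powr (1 / 4))) *
        sqrt (norm x) * sqrt (norm y))"
proof -
  interpret orthonormal_sequence smul ip e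
    by (intro orthonormal_sequence.intro orthonormal_sequence_axioms.intro assms(1,3))
  define D where "D = sqrt (\<Sum>i. (norm (\<Gamma> i - \<gamma> i))\<^sup>2)"
  define D' where "D' = sqrt (\<Sum>i. (norm (\<Phi> i - \<phi> i))\<^sup>2)"
  define p where "p = (\<Sum>i. (norm (\<Gamma> i + \<gamma> i))\<^sup>2) powr (1 / 4)"
  define p' where "p' = (\<Sum>i. (norm (\<Phi> i + \<phi> i))\<^sup>2) powr (1 / 4)"
  define A where "A = sqrt (norm x + norm (proj x))"
  define A' where "A' = sqrt (norm y + norm (proj y))"
  note defs = D_def D'_def p_def p'_def A_def A'_def
  \<comment> \<open>Both are norms of combinations, by Parseval.\<close>
  have "0 \<le> D" "0 \<le> D'"
    unfolding D_def D'_def norm_comb[OF ell2_diff[OF assms(4,5)], symmetric]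
      norm_comb[OF ell2_diff[OF assms(7,6)], symmetric] by (rule norm_ge_zero)+
  moreover have "0 \<le> p" "0 \<le> p'" "0 \<le> A" "0 \<le> A'"
    by (simp_all add: p_def p'_def A_def A'_def)
  ultimately have nonneg:
    "0 \<le> D" "0 \<le> D'" "0 \<le> p" "0 \<le> p'" "0 \<le> A" "0 \<le> A'" .
  have iff: "ball_condition \<longleftrightarrow> re_condition"
    unfolding ball_condition_def re_condition_def
    using ball_iff_re[OF assms(4,5), of x] ball_iff_re[OF assms(7,6), of y]
    unfolding comb_def by blast
  have middle: "middle = 1 / 4 * D' * D * (A * A' / (p' * p))"
    by (simp add: middle_def defs norm_proj)
  have "norm (ip x y - (\<Sum>i. ip x (e i) * ip (e i) y)) \<le> middle" if ball_condition
  proof -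
    have "norm (x - proj x) \<le> 1 / 2 * D * A / p"
      using norm_diff_proj_le[OF assms(4,5,9), of x] that
      by (simp add: ball_condition_def comb_def defs)
    moreover have "norm (y - proj y) \<le> 1 / 2 * D' * A' / p'"
      using norm_diff_proj_le[OF assms(7,6,11), of y] that
      by (simp add: ball_condition_def comb_def defs)
    \<comment> \<open>The factors 1/2 of the two radii multiply to the 1/4 of
      \<open>middle\<close>.\<close>
    ultimately have "norm (x - proj x) * norm (y - proj y)
        \<le> (1 / 2 * D * A / p) * (1 / 2 * D' * A' / p')"
      using nonneg by (intro mult_mono) simp_all
    also have "\<dots> = middle"
      by (simp add: middle mult_ac)
    finally show ?thesis
      unfolding ip_diff_proj using Cauchy_Schwarz_ip[of "x - proj x" "y - proj y"] by linarith
  qed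
  moreover have "middle \<le> 1 / 2 * (D' * D / (p' * p)) * sqrt (norm x) * sqrt (norm y)"
  proof -
    \<comment> \<open>The two factors \<open>sqrt 2\<close> combine to 2, which turns the constant
      1/4 into 1/2.\<close>
    have "A * A' \<le> (sqrt 2 * sqrt (norm x)) * (sqrt 2 * sqrt (norm y))"
      using sqrt_norm_add_proj_le nonneg by (intro mult_mono) (simp_all add: A_def A'_def)
    then have "A * A' \<le> 2 * (sqrt (norm x) * sqrt (norm y))"
      by (simp add: mult_ac flip: mult.assoc[of "sqrt 2" "sqrt 2"])
    then have "1 / 4 * (D' * D / (p' * p)) * (A * A')
        \<le> 1 / 4 * (D' * D / (p' * p)) * (2 * (sqrt (norm x) * sqrt (norm y)))"
      using nonneg by (intro mult_left_mono) simp_all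
    then show ?thesis by (simp add: middle mult_ac)
  qed
  ultimately show ?thesis
    using iff unfolding D_def D'_def p_def p'_def by blast
qed

end
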